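(* Let $p=2$. For a square-free integer $\ell>0$ with $\ell\equiv 7 \pmod 8$, let $K=\mathbb{Q}(\sqrt{-\ell})$, $\omega_\ell=\frac{-1+\sqrt{-\ell}}{2}$, $\mathcal{O}_K=\mathbb{Z}[\omega_\ell]$, and $\mathcal{R}=\mathcal{O}_K/2\mathcal{O}_K=\{0,1,\omega,\omega+1\}\cong\mathbb{F}_2\times\mathbb{F}_2$, where $\omega$ is the image of $\omega_\ell$ (so $\omega^2+\omega=0$ in $\mathcal{R}$). For any integer $n\geq 2$, consider the length-$n$ codes $$C_{n,1}=\omega\langle(0,\dots,0,1,1)\rangle+(\omega+1)\langle(0,\dots,0,1,1)\rangle^\perp,\qquad C_{n,2}=\omega\langle(0,\dots,0,0,1)\rangle+(\omega+1)\langle(0,\dots,0,0,1)\rangle^\perp$$ in $\mathcal{R}^n$. Then $swe_{C_{n,1}}\neq swe_{C_{n,2}}$, the level-$7$ theta series coincide, $\theta_{\Lambda_7(C_{n,1})}(q)=\theta_{\Lambda_7(C_{n,2})}(q)$, and for every square-free $\ell>7$ with $\ell\equiv 7\pmod 8$ the level-$\ell$ theta series differ, $\theta_{\Lambda_\ell(C_{n,1})}(q)\neq\theta_{\Lambda_\ell(C_{n,2})}(q)$.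
   Context: Conventions. For $\mathbf{v}\in\mathcal{R}^n$, $\langle\mathbf{v}\rangle=\{c\mathbf{v}: c\in\mathcal{R}\}$ is the $\mathcal{R}$-submodule generated by $\mathbf{v}$, and for a submodule $C\subseteq\mathcal{R}^n$, $C^\perp=\{u\in\mathcal{R}^n: \sum_i u_i\overline{v_i}=0 \text{ for all } v\in C\}$, where conjugation on $\mathcal{R}$ is induced by complex conjugation on $\mathcal{O}_K$, i.e. $\overline{a+b\omega}=(a-b)-b\omega$. For $a_1,a_2\in\mathcal{R}$, $a_1\langle\mathbf{v}\rangle+a_2\langle\mathbf{v}\rangle^\perp=\{a_1x+a_2y : x\in\langle\mathbf{v}\rangle, y\in\langle\mathbf{v}\rangle^\perp\}$. Symmetric weight enumerator: for a code $C\subseteq\mathcal{R}^n$, $swe_C(X,Y,Z)=\sum_{u\in C}X^{n_0(u)}Y^{n_1(u)}Z^{n_\omega(u)+n_{\omega+1}(u)}$, where $n_r(u)$ is the number of coordinates of $u$ equal to $r\in\mathcal{R}$. Construction A and theta series: with $\rho_\ell:\mathcal{O}_K\to\mathcal{R}$ the reduction map, $\Lambda_\ell(C)=\{u\in\mathcal{O}_K^n : (\rho_\ell(u_1),\dots,\rho_\ell(u_n))\in C\}$, and its theta series is $\theta_{\Lambda_\ell(C)}(q)=\sum_{z\in\Lambda_\ell(C)}q^{z\cdot\bar z}$, where $z\cdot\bar z=\sum_i|z_i|^2$, regarded as a formal power series in $q$. *)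

theory Defs
  imports
    "HOL-Analysis.Analysis"
    "HOL-Algebra.QuotRing"
    "HOL-Number_Theory.Cong"
    "HOL-Computational_Algebra.Squarefree"
    "HOL-Computational_Algebra.Polynomial_Factorial"
    "HOL-Computational_Algebra.Formal_Power_Series"
    "HOL-Library.Poly_Mapping"
begin

subsection \<open>The field, its ring of integers, and the residue ring modulo 2\<close>

definition quad_field :: "int \<Rightarrow> complex set" where
  "quad_field l = {of_rat r + of_rat s * csqrt (- of_int l) | r s. True}"

definition omega :: "int \<Rightarrow> complex" where
  "omega l = (- 1 + csqrt (- of_int l)) / 2"

definition OK :: "int \<Rightarrow> complex ring" where
  "OK l = \<lparr>carrier = {x \<in> quad_field l. algebraic_int x},
           monoid.mult = (*), monoid.one = 1,
           ring.zero = 0, ring.add = (+)\<rparr>"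

definition RR :: "int \<Rightarrow> complex set ring" where
  "RR l = OK l Quot (PIdl\<^bsub>OK l\<^esub> 2)"

definition rho :: "int \<Rightarrow> complex \<Rightarrow> complex set" where
  "rho l x = (PIdl\<^bsub>OK l\<^esub> 2) +>\<^bsub>OK l\<^esub> x"

abbreviation omegaR :: "int \<Rightarrow> complex set" where
  "omegaR l \<equiv> rho l (omega l)"

abbreviation omegaR1 :: "int \<Rightarrow> complex set" where
  "omegaR1 l \<equiv> omegaR l \<oplus>\<^bsub>RR l\<^esub> \<one>\<^bsub>RR l\<^esub>"

text \<open>An element of the residue ring is a coset, i.e. a set of complex numbers; the conjugation
  induced on the residue ring maps a coset to its image under complex conjugation
  (see \<open>conjR_rho\<close> and \<open>cnj_omega\<close> below).\<close>

definition conjR :: "complex set \<Rightarrow> complex set" where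
  "conjR A = cnj ` A"


subsection \<open>Vectors and codes of length \<open>n\<close>\<close>

text \<open>Vectors of length \<open>n\<close> are extensional functions on \<open>{..<n}\<close>; the coordinate written
  \<open>i\<close>-th in a tuple has index \<open>i - 1\<close>.\<close>

definition vecs :: "nat \<Rightarrow> 'a set \<Rightarrow> (nat \<Rightarrow> 'a) set" where
  "vecs n A = {..<n} \<rightarrow>\<^sub>E A"

definition smult_vec :: "int \<Rightarrow> nat \<Rightarrow> complex set \<Rightarrow> (nat \<Rightarrow> complex set) \<Rightarrow> nat \<Rightarrow> complex set" where
  "smult_vec l n c v = (\<lambda>i\<in>{..<n}. c \<otimes>\<^bsub>RR l\<^esub> v i)"

definition add_vec ::
    "int \<Rightarrow> nat \<Rightarrow> (nat \<Rightarrow> complex set) \<Rightarrow> (nat \<Rightarrow> complex set) \<Rightarrow> nat \<Rightarrow> complex set" where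
  "add_vec l n u v = (\<lambda>i\<in>{..<n}. u i \<oplus>\<^bsub>RR l\<^esub> v i)"

definition gen_code :: "int \<Rightarrow> nat \<Rightarrow> (nat \<Rightarrow> complex set) \<Rightarrow> (nat \<Rightarrow> complex set) set" where
  "gen_code l n v = {smult_vec l n c v | c. c \<in> carrier (RR l)}"

definition dual_code ::
    "int \<Rightarrow> nat \<Rightarrow> (nat \<Rightarrow> complex set) set \<Rightarrow> (nat \<Rightarrow> complex set) set" where
  "dual_code l n C = {u \<in> vecs n (carrier (RR l)).
     \<forall>v\<in>C. (\<Oplus>\<^bsub>RR l\<^esub>i\<in>{..<n}. u i \<otimes>\<^bsub>RR l\<^esub> conjR (v i)) = \<zero>\<^bsub>RR l\<^esub>}"

definition comb_code ::
    "int \<Rightarrow> nat \<Rightarrow> complex set \<Rightarrow> complex set \<Rightarrow> (nat \<Rightarrow> complex set) \<Rightarrow> (nat \<Rightarrow> complex set) set" where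
  "comb_code l n a1 a2 v =
     {add_vec l n (smult_vec l n a1 x) (smult_vec l n a2 y) | x y.
        x \<in> gen_code l n v \<and> y \<in> dual_code l n (gen_code l n v)}"

definition vec1 :: "int \<Rightarrow> nat \<Rightarrow> nat \<Rightarrow> complex set" where
  "vec1 l n = (\<lambda>i\<in>{..<n}. if i = n - 2 \<or> i = n - 1 then \<one>\<^bsub>RR l\<^esub> else \<zero>\<^bsub>RR l\<^esub>)"

definition vec2 :: "int \<Rightarrow> nat \<Rightarrow> nat \<Rightarrow> complex set" where
  "vec2 l n = (\<lambda>i\<in>{..<n}. if i = n - 1 then \<one>\<^bsub>RR l\<^esub> else \<zero>\<^bsub>RR l\<^esub>)"

definition code1 :: "int \<Rightarrow> nat \<Rightarrow> (nat \<Rightarrow> complex set) set" where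
  "code1 l n = comb_code l n (omegaR l) (omegaR1 l) (vec1 l n)"

definition code2 :: "int \<Rightarrow> nat \<Rightarrow> (nat \<Rightarrow> complex set) set" where
  "code2 l n = comb_code l n (omegaR l) (omegaR1 l) (vec2 l n)"


subsection \<open>Symmetric weight enumerator\<close>

text \<open>A polynomial with integer coefficients in variables indexed by \<^typ>\<open>nat\<close> is a finitely
  supported map from monomials (finitely supported exponent maps) to coefficients.\<close>

type_synonym mpoly_int = "(nat \<Rightarrow>\<^sub>0 nat) \<Rightarrow>\<^sub>0 int"

definition mvar :: "nat \<Rightarrow> mpoly_int" where
  "mvar i = Poly_Mapping.single (Poly_Mapping.single i 1) 1"

definition ncoord :: "nat \<Rightarrow> 'a \<Rightarrow> (nat \<Rightarrow> 'a) \<Rightarrow> nat" where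
  "ncoord n r u = card {i. i < n \<and> u i = r}"

text \<open>The variables $X$, $Y$, $Z$ are \<open>mvar 0\<close>, \<open>mvar 1\<close>, \<open>mvar 2\<close>.\<close>

definition swe :: "int \<Rightarrow> nat \<Rightarrow> (nat \<Rightarrow> complex set) set \<Rightarrow> mpoly_int" where
  "swe l n C = (\<Sum>u\<in>C. mvar 0 ^ ncoord n \<zero>\<^bsub>RR l\<^esub> u * mvar 1 ^ ncoord n \<one>\<^bsub>RR l\<^esub> u
                      * mvar 2 ^ (ncoord n (omegaR l) u + ncoord n (omegaR1 l) u))"


subsection \<open>Construction A and theta series\<close>

definition constrA :: "int \<Rightarrow> nat \<Rightarrow> (nat \<Rightarrow> complex set) set \<Rightarrow> (nat \<Rightarrow> complex) set" where
  "constrA l n C = {u \<in> vecs n (carrier (OK l)). (\<lambda>i\<in>{..<n}. rho l (u i)) \<in> C}"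

definition herm_norm :: "nat \<Rightarrow> (nat \<Rightarrow> complex) \<Rightarrow> complex" where
  "herm_norm n z = (\<Sum>i<n. z i * cnj (z i))"

text \<open>The formal series $\sum_{z \in L} q^{z \cdot \bar z}$: its $k$-th coefficient is the number of
  $z \in L$ with $z \cdot \bar z = k$. For $L$ contained in the $n$-th power of the ring of integers,
  these exponents are natural numbers and the sets counted are finite (\<open>herm_norm_Nats\<close> and
  \<open>finite_herm_norm\<close> below).\<close>

definition theta :: "nat \<Rightarrow> (nat \<Rightarrow> complex) set \<Rightarrow> int fps" where
  "theta n L = Abs_fps (\<lambda>k. int (card {z \<in> L. herm_norm n z = of_nat k}))"


subsection \<open>Validation of the definitions\<close>

lemma omega_complex: "l > 0 \<Longrightarrow> omega l = Complex (-1/2) (sqrt (of_int l) / 2)"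
  by (simp add: omega_def complex_eq_iff)

lemma omega_quadratic: "omega l * omega l = - omega l - of_int (l + 1) / 4"
proof -
  have "csqrt (- of_int l) * csqrt (- of_int l) = - of_int l"
    by (metis power2_csqrt power2_eq_square)
  then show ?thesis by (simp add: omega_def field_simps)
qed

lemma omega_square:
  assumes "l = 4 * k + 3"
  shows "omega l * omega l = - omega l - of_int (k + 1)"
proof -
  have "(of_int (l + 1) :: complex) = 4 * of_int (k + 1)" by (simp add: assms)
  then have "of_int (l + 1) / 4 = (of_int (k + 1) :: complex)"
    by (metis nonzero_mult_div_cancel_left zero_neq_numeral)
  then show ?thesis by (simp only: omega_quadratic)
qed

lemma cnj_omega: "l > 0 \<Longrightarrow> cnj (omega l) = - 1 - omega l"
  by (simp add: omega_complex complex_eq_iff)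

lemma quadratic_algebraic_int:
  fixes x :: complex
  assumes "x * x = of_int b * x + of_int c"
  shows "algebraic_int x"
proof (rule algebraic_int.intros)
  let ?p = "[:- of_int c, - of_int b, 1:] :: complex poly"
  show "lead_coeff ?p = 1" by simp
  show "\<forall>i. coeff ?p i \<in> \<int>" by (auto simp: coeff_pCons split: nat.splits)
  show "poly ?p x = 0" using assms by (simp add: algebra_simps)
qed

lemma of_rat_complex: "(of_rat r :: complex) = of_real (of_rat r)"
  by (cases r) (simp add: of_rat_rat)

lemma int_quadratic_factor:
  fixes x :: complex and p :: "int poly" and c b a :: int
  assumes lead: "lead_coeff p = 1" and root: "poly (map_poly of_int p) x = 0"
    and c: "c \<noteq> 0" and im: "Im x \<noteq> 0"
    and q: "of_int c * x * x + of_int b * x + of_int a = 0"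
  shows "c dvd b \<and> c dvd a"
proof -
  define A where "A = [:a, b, c:]"
  have degA: "degree A = 2" and A0: "A \<noteq> 0" and lcA: "lead_coeff A = c"
    using c by (auto simp: A_def)
  obtain D E where DE: "pseudo_divmod p A = (D, E)" by fastforce
  define k where "k = Suc (degree p) - degree A"
  have eq: "smult (c ^ k) p = A * D + E" and E: "E = 0 \<or> degree E < degree A"
    using pseudo_divmod[OF A0 DE] by (auto simp: k_def lcA)
  have mA: "poly (map_poly of_int A) x = 0"
    using q by (simp add: A_def map_poly_pCons algebra_simps)
  have hom: "map_poly (of_int :: int \<Rightarrow> complex) (A * D + E) =
      map_poly of_int A * map_poly of_int D + map_poly of_int E"
    by (intro poly_eqI) (simp add: coeff_map_poly coeff_mult)
  have homs: "map_poly (of_int :: int \<Rightarrow> complex) (smult (c ^ k) p) =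
      smult (of_int (c ^ k)) (map_poly of_int p)"
    by (intro poly_eqI) (simp add: coeff_map_poly)
  have "poly (map_poly of_int (smult (c ^ k) p)) x = 0"
    using root by (simp add: homs)
  then have Ex: "poly (map_poly of_int E) x = 0"
    unfolding eq hom using mA by simp
  have "E = 0"
  proof -
    have dE: "degree E \<le> 1" using E degA by auto
    define e0 e1 where "e0 = coeff E 0" and "e1 = coeff E 1"
    have Edef: "E = [:e0, e1:]"
    proof (rule poly_eqI)
      fix i show "coeff E i = coeff [:e0, e1:] i"
        using dE coeff_eq_0[of E i]
        by (cases i; cases "i - 1") (auto simp: e0_def e1_def)
    qed
    have e: "of_int e0 + x * of_int e1 = 0"
      using Ex by (simp add: Edef map_poly_pCons)
    from arg_cong[OF e, of Im] im have "e1 = 0" by simp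
    with e have "e0 = 0" by simp
    with \<open>e1 = 0\<close> show ?thesis by (simp add: Edef)
  qed
  with eq have eq': "smult (c ^ k) p = A * D" by simp
  have contp: "content p = 1"
    using content_dvd_coeff[of p "degree p"] lead
    by (metis is_unit_content_iff)
  have "content (smult (c ^ k) p) = content A * content D"
    by (simp add: eq' content_mult)
  then have cont: "\<bar>c ^ k\<bar> = content A * content D"
    by (simp add: contp)
  have "lead_coeff (smult (c ^ k) p) = c * lead_coeff D"
    by (simp add: eq' lead_coeff_mult lcA)
  then have lc: "c ^ k = c * lead_coeff D" using lead c by simp
  have D0: "lead_coeff D \<noteq> 0" using lc c by (metis mult_zero_right power_not_zero)
  obtain u where u: "lead_coeff D = content D * u" using content_dvd_coeff by blast
  have "\<bar>c\<bar> * \<bar>content D\<bar> * \<bar>u\<bar> = content A * content D"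
    using cont lc u by (simp add: abs_mult)
  moreover have "content D > 0"
    using D0 by (metis content_eq_zero_iff leading_coeff_0_iff abs_ge_zero
        normalize_content normalize_int_def order_le_less)
  moreover have "D \<noteq> 0" using D0 by auto
  ultimately have "content A = \<bar>c\<bar> * \<bar>u\<bar>" by simp
  then have "c dvd content A" by simp
  then have "c dvd coeff A i" for i using content_dvd_coeff dvd_trans by blast
  from this[of 0] this[of 1] show ?thesis by (simp add: A_def)
qed

lemma square_rat_int:
  fixes t :: rat and l :: int
  assumes sf: "squarefree l" and int: "of_int l * t ^ 2 \<in> \<int>"
  shows "t \<in> \<int>"
proof -
  obtain u v where t: "t = of_int u / of_int v" and v: "v > 0" and cop: "coprime u v"
    by (metis Fract_of_int_quotient Rat_cases)
  from int obtain m where "of_int l * t ^ 2 = of_int m" by (auto elim: Ints_cases)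
  then have "(of_int (l * u ^ 2) :: rat) = of_int (m * v ^ 2)"
    using v by (simp add: t field_simps)
  then have "l * u ^ 2 = m * v ^ 2" by (simp only: of_int_eq_iff)
  then have "v ^ 2 dvd l * u ^ 2" by simp
  moreover have "coprime (v ^ 2) (u ^ 2)" using cop by (simp add: coprime_commute)
  ultimately have "v ^ 2 dvd l" by (simp add: coprime_dvd_mult_left_iff)
  with sf have "v dvd 1" by (rule squarefreeD)
  with v have "v = 1" by simp
  then show ?thesis by (simp add: t)
qed

lemma carrier_OK:
  assumes pos: "l > 0" and sf: "squarefree l" and l3: "[l = 3] (mod 4)"
  shows "carrier (OK l) = {of_int a + of_int b * omega l | a b. True}"
proof (intro equalityI subsetI)
  fix x assume "x \<in> {of_int a + of_int b * omega l | a b. True}"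
  then obtain a b where x: "x = of_int a + of_int b * omega l" by blast
  from l3 obtain k where k: "l = 4 * k + 3"
    by (metis cong_iff_lin mult.commute add.commute cong_sym)
  have om: "omega l * omega l = - omega l - of_int (k + 1)"
    by (rule omega_square[OF k])
  have "x * x = of_int (2 * a - b) * x + of_int (a * b - a * a - b * b * (k + 1))"
  proof -
    have "x * x = of_int (a * a) + of_int (2 * a * b) * omega l
        + of_int (b * b) * (omega l * omega l)"
      by (simp add: x algebra_simps)
    then show ?thesis unfolding om by (simp add: x algebra_simps)
  qed
  then have "algebraic_int x" by (rule quadratic_algebraic_int)
  moreover have "x \<in> quad_field l"
    unfolding quad_field_def
  proof (intro CollectI exI conjI TrueI)
    show "x = of_rat (of_int a - of_int b / 2) + of_rat (of_int b / 2) * csqrt (- of_int l)"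
      by (simp add: x omega_def of_rat_diff of_rat_divide of_rat_mult of_rat_add field_simps)
  qed
  ultimately show "x \<in> carrier (OK l)" by (simp add: OK_def)
next
  fix x assume "x \<in> carrier (OK l)"
  then have alg: "algebraic_int x" and "x \<in> quad_field l" by (auto simp: OK_def)
  then obtain r s where x: "x = of_rat r + of_rat s * csqrt (- of_int l)"
    by (auto simp: quad_field_def)
  have sq: "csqrt (- of_int l) * csqrt (- of_int l) = - of_int l"
    by (metis power2_csqrt power2_eq_square)
  show "x \<in> {of_int a + of_int b * omega l | a b. True}"
  proof (cases "s = 0")
    case True
    with x have "x = of_rat r" by simp
    then have "x \<in> \<int>" using alg rational_algebraic_int_is_int by (metis Rats_of_rat)
    then obtain a where "x = of_int a" by (auto elim: Ints_cases)
    then have "x = of_int a + of_int 0 * omega l" by simp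
    then show ?thesis by blast
  next
    case False
    have imx: "Im x = real_of_rat s * sqrt (of_int l)"
      using pos by (simp add: x of_rat_complex)
    have im: "Im x \<noteq> 0" using imx False pos by simp
    from alg obtain p where p: "lead_coeff p = 1" "poly (map_poly of_int p) x = 0"
      by (auto simp: algebraic_int_altdef_ipoly)
    define N where "N = r ^ 2 + of_int l * s ^ 2"
    have quad: "x * x - of_rat (2 * r) * x + of_rat N = 0"
    proof -
      have "x * x = of_rat (r ^ 2) + of_rat (2 * r * s) * csqrt (- of_int l)
          + of_rat (s ^ 2) * (csqrt (- of_int l) * csqrt (- of_int l))"
        by (simp add: x algebra_simps power2_eq_square of_rat_mult of_rat_add)
      then show ?thesis
        unfolding sq by (simp add: N_def x algebra_simps power2_eq_square of_rat_mult of_rat_add)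
    qed
    obtain u v where uv: "2 * r = of_int u / of_int v" "v > 0"
      by (metis Fract_of_int_quotient Rat_cases)
    obtain u' v' where uv': "N = of_int u' / of_int v'" "v' > 0"
      by (metis Fract_of_int_quotient Rat_cases)
    have "of_int (v * v') * x * x + of_int (- (u * v')) * x + of_int (u' * v) =
        of_int (v * v') * (x * x - of_rat (2 * r) * x + of_rat N)"
      using uv(2) uv'(2) unfolding uv(1) uv'(1) by (simp add: of_rat_divide field_simps)
    also have "\<dots> = 0" by (simp only: quad mult_zero_right)
    finally have "v * v' dvd - (u * v') \<and> v * v' dvd u' * v"
      using uv uv' im by (intro int_quadratic_factor[OF p]) auto
    then have "v dvd u" "v' dvd u'" using uv(2) uv'(2) by (auto simp: mult.commute)
    then obtain m n where m: "2 * r = of_int m" and n: "N = of_int n"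
      using uv uv' by (auto elim!: dvdE)
    have r: "r = of_int m / 2" using m by (simp add: field_simps)
    have eq4: "of_int l * (2 * s) ^ 2 = (of_int (4 * n - m ^ 2) :: rat)"
      using n by (simp add: N_def r field_simps power2_eq_square)
    then have "of_int l * (2 * s) ^ 2 \<in> (\<int> :: rat set)" by (metis Ints_of_int)
    then have "2 * s \<in> \<int>" by (rule square_rat_int[OF sf])
    then obtain t where t: "2 * s = of_int t" by (auto elim: Ints_cases)
    then have s: "s = of_int t / 2" by (simp add: field_simps)
    from eq4 have "(of_int (l * t ^ 2) :: rat) = of_int (4 * n - m ^ 2)" by (simp add: t)
    then have lt: "l * t ^ 2 = 4 * n - m ^ 2" by (simp only: of_int_eq_iff)
    have "odd l" using l3 by (simp add: cong_def) presburger
    have "even (l * t ^ 2) \<longleftrightarrow> even (m ^ 2)" unfolding lt by simp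
    then have "even (m + t)" using \<open>odd l\<close> by auto
    then obtain a where a: "m + t = 2 * a" by (meson evenE)
    then have m: "m = 2 * a - t" by simp
    then have "x = of_int a + of_int t * omega l"
      by (simp add: x r s m omega_def of_rat_divide of_rat_diff of_rat_mult field_simps)
    then show ?thesis by blast
  qed
qed

lemma OK_simps [simp]:
  "x \<otimes>\<^bsub>OK l\<^esub> y = x * y" "x \<oplus>\<^bsub>OK l\<^esub> y = x + y" "\<one>\<^bsub>OK l\<^esub> = 1" "\<zero>\<^bsub>OK l\<^esub> = 0"
  by (simp_all add: OK_def)

lemma cring_OK:
  assumes pos: "l > 0" and sf: "squarefree l" and l3: "[l = 3] (mod 4)"
  shows "cring (OK l)"
proof -
  note car = carrier_OK[OF assms]
  from l3 obtain k where k: "l = 4 * k + 3"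
    by (metis cong_iff_lin mult.commute add.commute cong_sym)
  have om: "omega l * omega l = - omega l - of_int (k + 1)" by (rule omega_square[OF k])
  have I: "of_int a + of_int b * omega l \<in> carrier (OK l)" for a b
    unfolding car by blast
  have add: "x + y \<in> carrier (OK l)" if xy: "x \<in> carrier (OK l)" "y \<in> carrier (OK l)" for x y
  proof -
    obtain a b c d where "x = of_int a + of_int b * omega l" "y = of_int c + of_int d * omega l"
      using xy unfolding car by blast
    then have "x + y = of_int (a + c) + of_int (b + d) * omega l" by (simp add: algebra_simps)
    then show ?thesis using I by metis
  qed
  have mult: "x * y \<in> carrier (OK l)" if xy: "x \<in> carrier (OK l)" "y \<in> carrier (OK l)" for x y
  proof -
    obtain a b c d where xy: "x = of_int a + of_int b * omega l" "y = of_int c + of_int d * omega l"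
      using xy unfolding car by blast
    have "x * y = of_int (a * c) + of_int (a * d + b * c) * omega l
        + of_int (b * d) * (omega l * omega l)"
      by (simp add: xy algebra_simps)
    also have "\<dots> = of_int (a * c - b * d * (k + 1)) + of_int (a * d + b * c - b * d) * omega l"
      unfolding om by (simp add: algebra_simps)
    finally show ?thesis using I by metis
  qed
  have minus: "- x \<in> carrier (OK l)" if x: "x \<in> carrier (OK l)" for x
  proof -
    obtain a b where "x = of_int a + of_int b * omega l"
      using x unfolding car by blast
    then have "- x = of_int (- a) + of_int (- b) * omega l" by (simp add: algebra_simps)
    then show ?thesis using I by metis
  qed
  have 0: "0 \<in> carrier (OK l)" using I[of 0 0] by simp
  have 1: "1 \<in> carrier (OK l)" using I[of 1 0] by simp
  show ?thesis
  proof (rule cringI)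
    show "abelian_group (OK l)"
    proof (rule abelian_groupI)
      fix x assume "x \<in> carrier (OK l)"
      then show "\<exists>y\<in>carrier (OK l). y \<oplus>\<^bsub>OK l\<^esub> x = \<zero>\<^bsub>OK l\<^esub>"
        by (intro bexI[of _ "- x"]) (auto simp: minus)
    qed (auto simp: add 0 algebra_simps)
    show "comm_monoid (OK l)"
      by (rule comm_monoidI) (auto simp: mult 1 algebra_simps)
  qed (simp add: algebra_simps)
qed

lemma rho_def': "rho l x = {2 * y + x | y. y \<in> carrier (OK l)}"
  unfolding rho_def a_r_coset_def' cgenideal_def by (auto simp: mult.commute)

lemma conjR_rho: "l > 0 \<Longrightarrow> conjR (rho l x) = rho l (cnj x)"
proof -
  assume l: "l > 0"
  have rat: "cnj (of_rat r) = of_rat r" for r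
    by (simp add: of_rat_complex)
  have "cnj y \<in> quad_field l" if y: "y \<in> quad_field l" for y
  proof -
    obtain r s where "y = of_rat r + of_rat s * csqrt (- of_int l)"
      using y by (auto simp: quad_field_def)
    moreover have "cnj (csqrt (- of_int l)) = - csqrt (- of_int l)"
      using l by simp
    ultimately have "cnj y = of_rat r + of_rat (- s) * csqrt (- of_int l)"
      by (simp add: rat of_rat_minus del: csqrt_of_real_nonpos csqrt_minus)
    then show ?thesis unfolding quad_field_def by blast
  qed
  then have cl: "cnj y \<in> carrier (OK l)" if "y \<in> carrier (OK l)" for y
    using that by (simp add: OK_def)
  show ?thesis
  proof (intro equalityI subsetI)
    fix z assume "z \<in> conjR (rho l x)"
    then show "z \<in> rho l (cnj x)" by (auto simp: conjR_def rho_def' intro: cl)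
  next
    fix z assume "z \<in> rho l (cnj x)"
    then obtain y where y: "y \<in> carrier (OK l)" "z = 2 * y + cnj x" by (auto simp: rho_def')
    then have "z = cnj (2 * cnj y + x)" "2 * cnj y + x \<in> rho l x"
      using cl[OF y(1)] by (auto simp: rho_def')
    then show "z \<in> conjR (rho l x)" unfolding conjR_def by blast
  qed
qed

lemma residue_ring:
  assumes pos: "l > 0" and sf: "squarefree l" and l7: "[l = 7] (mod 8)"
  shows "cring (RR l)"
    and "rho l \<in> ring_hom (OK l) (RR l)"
    and "carrier (RR l) = {\<zero>\<^bsub>RR l\<^esub>, \<one>\<^bsub>RR l\<^esub>, omegaR l, omegaR1 l}"
    and "card (carrier (RR l)) = 4"
    and "omegaR l \<otimes>\<^bsub>RR l\<^esub> omegaR l \<oplus>\<^bsub>RR l\<^esub> omegaR l = \<zero>\<^bsub>RR l\<^esub>"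
proof -
  from l7 obtain k where k: "l = 8 * k + 7"
    by (metis cong_iff_lin mult.commute add.commute cong_sym)
  have l3: "[l = 3] (mod 4)" by (simp add: k cong_def) presburger
  note car = carrier_OK[OF pos sf l3]
  interpret O: cring "OK l" by (rule cring_OK[OF pos sf l3])
  have I: "of_int a + of_int b * omega l \<in> carrier (OK l)" for a b
    unfolding car by blast
  have om: "omega l \<in> carrier (OK l)" using I[of 0 1] by simp
  have two: "2 \<in> carrier (OK l)" using I[of 2 0] by simp
  interpret P: ideal "PIdl\<^bsub>OK l\<^esub> 2" "OK l" by (rule O.cgenideal_ideal[OF two])
  show R: "cring (RR l)" unfolding RR_def by (rule P.quotient_is_cring) (rule O.is_cring)
  interpret R: cring "RR l" by (rule R)
  have rho_eq: "rho l = (+>\<^bsub>OK l\<^esub>) (PIdl\<^bsub>OK l\<^esub> 2)" by (rule ext) (simp add: rho_def)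
  show hom: "rho l \<in> ring_hom (OK l) (RR l)"
    unfolding rho_eq RR_def by (rule P.rcos_ring_hom)
  have h0: "\<zero>\<^bsub>RR l\<^esub> = rho l 0"
    using ring_hom_zero[OF hom O.ring_axioms R.ring_axioms] by simp
  have h1: "\<one>\<^bsub>RR l\<^esub> = rho l 1"
    using ring_hom_one[OF hom] by simp
  have hw: "omegaR l \<oplus>\<^bsub>RR l\<^esub> rho l 1 = rho l (1 + omega l)"
    using ring_hom_add[OF hom om O.one_closed] by (simp add: add.commute)
  have carR: "carrier (RR l) = rho l ` carrier (OK l)"
    by (auto simp: RR_def FactRing_def A_RCOSETS_def' rho_def)
  have eqI: "rho l (of_int a + of_int b * omega l) = rho l (of_int c + of_int d * omega l)"
    if ev: "even (a - c)" "even (b - d)" for a b c d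
  proof -
    obtain e f where ef: "a - c = 2 * e" "b - d = 2 * f" using ev by (meson evenE)
    then have a: "a = c + 2 * e" and b: "b = d + 2 * f" by auto
    have "of_int a + of_int b * omega l =
        2 * (of_int e + of_int f * omega l) + (of_int c + of_int d * omega l)"
      by (simp add: a b algebra_simps)
    then have "of_int a + of_int b * omega l \<in> rho l (of_int c + of_int d * omega l)"
      unfolding rho_def' using I by blast
    then show ?thesis
      using P.a_repr_independence'[OF _ I] by (simp add: rho_def)
  qed
  have eqD: "even (a - c) \<and> even (b - d)"
    if eq: "rho l (of_int a + of_int b * omega l) = rho l (of_int c + of_int d * omega l)"
    for a b c d
  proof -
    have "of_int a + of_int b * omega l \<in> rho l (of_int a + of_int b * omega l)"
      unfolding rho_def' using O.zero_closed by force
    then have "of_int a + of_int b * omega l \<in> rho l (of_int c + of_int d * omega l)"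
      by (simp only: eq)
    then obtain e f where e: "of_int a + of_int b * omega l =
        2 * (of_int e + of_int f * omega l) + (of_int c + of_int d * omega l)"
      unfolding rho_def' car by blast
    have "real_of_int b * sqrt (of_int l) = of_int (2 * f + d) * sqrt (of_int l)"
      using arg_cong[OF e, of Im] pos by (simp add: omega_complex field_simps)
    then have "real_of_int b = of_int (2 * f + d)" using pos by simp
    then have b: "b = 2 * f + d" by (simp only: of_int_eq_iff)
    have "complex_of_int a = of_int (2 * e + c)"
      using e by (simp add: b algebra_simps)
    then have "a = 2 * e + c" by (simp only: of_int_eq_iff)
    with b show ?thesis by simp
  qed
  show car4: "carrier (RR l) = {\<zero>\<^bsub>RR l\<^esub>, \<one>\<^bsub>RR l\<^esub>, omegaR l, omegaR1 l}"
  proof (intro equalityI subsetI)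
    fix z assume "z \<in> carrier (RR l)"
    then obtain a b where z: "z = rho l (of_int a + of_int b * omega l)"
      unfolding carR car by blast
    have "z = rho l (of_int (a mod 2) + of_int (b mod 2) * omega l)"
      unfolding z by (rule eqI) (simp_all add: minus_mod_eq_mult_div)
    moreover have "a mod 2 = 0 \<or> a mod 2 = 1" "b mod 2 = 0 \<or> b mod 2 = 1" by auto
    ultimately show "z \<in> {\<zero>\<^bsub>RR l\<^esub>, \<one>\<^bsub>RR l\<^esub>, omegaR l, omegaR1 l}"
      unfolding h0 h1 hw by auto
  next
    fix z assume "z \<in> {\<zero>\<^bsub>RR l\<^esub>, \<one>\<^bsub>RR l\<^esub>, omegaR l, omegaR1 l}"
    then show "z \<in> carrier (RR l)"
      using om ring_hom_closed[OF hom om] by auto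
  qed
  have "distinct [\<zero>\<^bsub>RR l\<^esub>, \<one>\<^bsub>RR l\<^esub>, omegaR l, omegaR1 l]"
    unfolding h0 h1 hw
    using eqD[of 0 0 1 0] eqD[of 0 0 0 1] eqD[of 0 0 1 1] eqD[of 1 0 0 1] eqD[of 1 0 1 1]
      eqD[of 0 1 1 1]
    by auto
  then have "card (set [\<zero>\<^bsub>RR l\<^esub>, \<one>\<^bsub>RR l\<^esub>, omegaR l, omegaR1 l]) = 4"
    by (simp only: distinct_card) simp
  then show "card (carrier (RR l)) = 4" by (simp add: car4)
  have "omega l * omega l + omega l = of_int (- 2 * (k + 1)) + of_int 0 * omega l"
    using omega_square[of l "2 * k + 1"] by (simp add: k)
  then have "rho l (omega l * omega l + omega l) = rho l (of_int 0 + of_int 0 * omega l)"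
    by (simp only:) (rule eqI; simp)
  then show "omegaR l \<otimes>\<^bsub>RR l\<^esub> omegaR l \<oplus>\<^bsub>RR l\<^esub> omegaR l = \<zero>\<^bsub>RR l\<^esub>"
    using ring_hom_mult[OF hom om om] ring_hom_add[OF hom O.m_closed[OF om om] om]
    by (simp add: h0)
qed

text \<open>In particular the sum defining \<open>swe\<close> ranges over a finite set for \<open>code1\<close> and \<open>code2\<close>.\<close>

lemma comb_code_finite:
  assumes pos: "l > 0" and sf: "squarefree l" and l7: "[l = 7] (mod 8)"
    and a: "a1 \<in> carrier (RR l)" "a2 \<in> carrier (RR l)" and v: "v \<in> vecs n (carrier (RR l))"
  shows "comb_code l n a1 a2 v \<subseteq> vecs n (carrier (RR l))" "finite (comb_code l n a1 a2 v)"
proof -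
  interpret R: cring "RR l" by (rule residue_ring(1)[OF pos sf l7])
  show sub: "comb_code l n a1 a2 v \<subseteq> vecs n (carrier (RR l))"
    using a v unfolding comb_code_def gen_code_def dual_code_def vecs_def
    by (auto simp: add_vec_def smult_vec_def PiE_iff)
  have "finite (carrier (RR l))" by (simp add: residue_ring(3)[OF pos sf l7])
  then have "finite (vecs n (carrier (RR l)))" by (auto simp: vecs_def intro: finite_PiE)
  with sub show "finite (comb_code l n a1 a2 v)" by (rule finite_subset)
qed

lemma norm_OK:
  assumes "l > 0"
  shows "(of_int a + of_int b * omega l) * cnj (of_int a + of_int b * omega l) =
    of_int ((2 * a - b) ^ 2 + l * b ^ 2) / 4"
proof -
  have "sqrt (of_int l) * sqrt (of_int l) = real_of_int l" using assms by simp
  then have "sqrt (of_int l) * (sqrt (of_int l) * y) = of_int l * y" for y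
    by (metis mult.assoc)
  then show ?thesis
    using assms by (simp add: omega_complex complex_eq_iff power2_eq_square field_simps)
qed

lemma herm_norm_Nats:
  assumes pos: "l > 0" and sf: "squarefree l" and l3: "[l = 3] (mod 4)"
    and z: "z \<in> vecs n (carrier (OK l))"
  shows "herm_norm n z \<in> \<nat>"
proof -
  have "z i * cnj (z i) \<in> \<nat>" if "i < n" for i
  proof -
    have "z i \<in> carrier (OK l)" using z that by (auto simp: vecs_def)
    then obtain a b where ab: "z i = of_int a + of_int b * omega l"
      unfolding carrier_OK[OF pos sf l3] by blast
    from l3 obtain k where k: "l = 4 * k + 3"
      by (metis cong_iff_lin mult.commute add.commute cong_sym)
    define N where "N = a ^ 2 - a * b + b ^ 2 * (k + 1)"
    have N: "(2 * a - b) ^ 2 + l * b ^ 2 = 4 * N"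
      by (simp add: k N_def power2_eq_square algebra_simps)
    then have "N \<ge> 0" using pos
      by (metis add_nonneg_nonneg less_imp_le mult_nonneg_nonneg zero_le_mult_iff
          zero_le_power2 zero_less_numeral not_less)
    moreover have "z i * cnj (z i) = of_int N"
      unfolding ab norm_OK[OF pos] N by simp
    ultimately show "z i * cnj (z i) \<in> \<nat>"
      by (metis of_nat_in_Nats of_nat_nat)
  qed
  then have "(\<Sum>i<m. z i * cnj (z i)) \<in> \<nat>" if "m \<le> n" for m
    using that by (induction m) auto
  then show ?thesis by (simp add: herm_norm_def)
qed

lemma finite_herm_norm:
  assumes pos: "l > 0" and sf: "squarefree l" and l3: "[l = 3] (mod 4)"
    and L: "L \<subseteq> vecs n (carrier (OK l))"
  shows "finite {z \<in> L. herm_norm n z = of_nat k}"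
proof (rule finite_subset)
  let ?m = "4 * int k"
  let ?S = "(\<lambda>(a, b). of_int a + of_int b * omega l) ` ({- ?m..?m} \<times> {- ?m..?m})"
  show "finite ({..<n} \<rightarrow>\<^sub>E ?S)" by (intro finite_PiE) auto
  show "{z \<in> L. herm_norm n z = of_nat k} \<subseteq> {..<n} \<rightarrow>\<^sub>E ?S"
  proof
    fix z assume "z \<in> {z \<in> L. herm_norm n z = of_nat k}"
    then have zv: "z \<in> vecs n (carrier (OK l))" and nz: "herm_norm n z = of_nat k"
      using L by auto
    have "(\<Sum>i<n. (cmod (z i))\<^sup>2) = Re (herm_norm n z)"
      by (simp add: herm_norm_def complex_norm_square[symmetric] flip: of_real_sum of_real_power)
    then have sum: "(\<Sum>i<n. (cmod (z i))\<^sup>2) = k" by (simp add: nz)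
    have "z i \<in> ?S" if i: "i < n" for i
    proof -
      have le: "(cmod (z i))\<^sup>2 \<le> k"
        unfolding sum[symmetric] using i by (intro member_le_sum) auto
      have "z i \<in> carrier (OK l)" using zv i by (auto simp: vecs_def)
      then obtain a b where ab: "z i = of_int a + of_int b * omega l"
        unfolding carrier_OK[OF pos sf l3] by blast
      have "complex_of_real ((cmod (z i))\<^sup>2) = of_int ((2 * a - b) ^ 2 + l * b ^ 2) / 4"
        unfolding complex_norm_square by (simp only: ab norm_OK[OF pos])
      also have "\<dots> = complex_of_real (of_int ((2 * a - b) ^ 2 + l * b ^ 2) / 4)" by simp
      finally have "(cmod (z i))\<^sup>2 = of_int ((2 * a - b) ^ 2 + l * b ^ 2) / 4"
        by (simp only: of_real_eq_iff)
      with le have "real_of_int ((2 * a - b) ^ 2 + l * b ^ 2) \<le> of_int ?m" by simp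
      then have le': "(2 * a - b) ^ 2 + l * b ^ 2 \<le> ?m" by (simp only: of_int_le_iff)
      have abs_le: "\<bar>x\<bar> \<le> x ^ 2" for x :: int
        by (metis abs_le_square_iff abs_ge_zero abs_of_nonneg linorder_not_le power2_abs
            int_one_le_iff_zero_less mult_le_cancel_right1 power2_eq_square zero_less_abs_iff
            abs_0_eq order_refl power_zero_numeral)
      have "b ^ 2 \<le> l * b ^ 2" using pos by (simp add: mult_le_cancel_right1)
      moreover have "0 \<le> (2 * a - b) ^ 2" "0 \<le> b ^ 2" by auto
      ultimately have "b ^ 2 \<le> ?m" "(2 * a - b) ^ 2 \<le> ?m" using le' by linarith+
      then have "\<bar>b\<bar> \<le> ?m" "\<bar>2 * a - b\<bar> \<le> ?m"
        using abs_le order_trans by blast+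
      then have "(a, b) \<in> {- ?m..?m} \<times> {- ?m..?m}" by auto
      then show ?thesis unfolding ab by force
    qed
    then show "z \<in> {..<n} \<rightarrow>\<^sub>E ?S" using zv by (auto simp: vecs_def PiE_def Pi_def)
  qed
qed

end

theory Submission
  imports Defs
begin

text \<open>
  Since \<open>\<omega>\<close> and \<open>\<omega> + 1\<close> are complementary orthogonal idempotents of the residue ring, the second
  code is \<open>{0, \<omega> + 1}\<close> in the first \<open>n - 1\<close> coordinates times \<open>{0, \<omega>}\<close>, while the first code is
  \<open>{0, \<omega> + 1}\<close> in the first \<open>n - 2\<close> coordinates times the diagonal. Only the first code has a word
  with a coordinate equal to \<open>1\<close>, which separates the weight enumerators. For \<open>\<ell> = 7\<close> the last two
  coordinates of the lattices range over \<open>{(\<pi>' a, \<pi> b)}\<close> and \<open>{(x, y). x \<equiv> y (mod 2)} = {(a + b, a - b)}\<close>,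
  where \<open>\<pi> = \<omega>\<^sub>7\<close> and its conjugate \<open>\<pi>'\<close> have norm 2; both have norm \<open>2 |a|\<^sup>2 + 2 |b|\<^sup>2\<close>. For \<open>\<ell> > 7\<close>
  the first lattice contains \<open>(0, \<dots>, 0, 1, 1)\<close>, whereas elements of norm at most 2 in the ring of
  integers are rational integers, and those occurring as coordinates in the second lattice are even,
  so the second lattice has no vector of norm 2.
\<close>

section \<open>Monomials of the weight enumerator\<close>

lemma mvar_power: "mvar i ^ k = Poly_Mapping.single (Poly_Mapping.single i k) 1"
proof (induction k)
  case (Suc k)
  then show ?case
    by (simp add: mvar_def mult_single single_add[symmetric])
qed simp

section \<open>Arithmetic in the ring of integers and its residue ring modulo 2\<close>

locale residue_mod_two =
  fixes l :: int
  assumes pos: "l > 0" and sf: "squarefree l" and l7: "[l = 7] (mod 8)"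
begin

lemma l3: "[l = 3] (mod 4)"
  using l7 unfolding cong_def by presburger

sublocale O: cring "OK l"
  by (rule cring_OK[OF pos sf l3])

sublocale R: cring "RR l"
  by (rule residue_ring(1)[OF pos sf l7])

abbreviation "\<O> \<equiv> carrier (OK l)"
abbreviation "e \<equiv> omegaR l"
abbreviation "f \<equiv> omegaR1 l"

lemma OK_ops [simp]:
  "x \<oplus>\<^bsub>OK l\<^esub> y = x + y" "x \<otimes>\<^bsub>OK l\<^esub> y = x * y" "\<zero>\<^bsub>OK l\<^esub> = 0" "\<one>\<^bsub>OK l\<^esub> = 1"
  by (simp_all add: OK_def)

lemma OK_iff: "x \<in> \<O> \<longleftrightarrow> (\<exists>a b. x = of_int a + of_int b * omega l)"
  unfolding carrier_OK[OF pos sf l3] by blast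

lemma of_int_OK [simp]: "of_int a \<in> \<O>"
  unfolding OK_iff by (rule exI[of _ a], rule exI[of _ 0]) simp

lemma OK_numerals [simp]: "0 \<in> \<O>" "1 \<in> \<O>" "2 \<in> \<O>"
  using of_int_OK[of 0] of_int_OK[of 1] of_int_OK[of 2] by simp_all

lemma omega_OK [simp]: "omega l \<in> \<O>"
  unfolding OK_iff by (rule exI[of _ 0], rule exI[of _ 1]) simp

lemma OK_add [simp]: "x \<in> \<O> \<Longrightarrow> y \<in> \<O> \<Longrightarrow> x + y \<in> \<O>"
  using O.a_closed by simp

lemma OK_mult [simp]: "x \<in> \<O> \<Longrightarrow> y \<in> \<O> \<Longrightarrow> x * y \<in> \<O>"
  using O.m_closed by simp

lemma OK_uminus [simp]: "x \<in> \<O> \<Longrightarrow> - x \<in> \<O>"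
  using OK_mult[OF of_int_OK[of "- 1"]] by simp

lemma OK_diff [simp]: "x \<in> \<O> \<Longrightarrow> y \<in> \<O> \<Longrightarrow> x - y \<in> \<O>"
  using OK_add[OF _ OK_uminus, of x y] by simp

lemma cnj_omega_OK [simp]: "cnj (omega l) \<in> \<O>"
  by (simp add: cnj_omega[OF pos])

lemma rho_hom: "rho l \<in> ring_hom (OK l) (RR l)"
  by (rule residue_ring(2)[OF pos sf l7])

lemma rho_closed [simp]: "x \<in> \<O> \<Longrightarrow> rho l x \<in> carrier (RR l)"
  by (rule ring_hom_closed[OF rho_hom])

lemma rho_mult: "x \<in> \<O> \<Longrightarrow> y \<in> \<O> \<Longrightarrow> rho l (x * y) = rho l x \<otimes>\<^bsub>RR l\<^esub> rho l y"
  using ring_hom_mult[OF rho_hom] by simp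

lemma rho_add: "x \<in> \<O> \<Longrightarrow> y \<in> \<O> \<Longrightarrow> rho l (x + y) = rho l x \<oplus>\<^bsub>RR l\<^esub> rho l y"
  using ring_hom_add[OF rho_hom] by simp

lemma rho_0: "rho l 0 = \<zero>\<^bsub>RR l\<^esub>"
  using ring_hom_zero[OF rho_hom O.ring_axioms R.ring_axioms] by simp

lemma rho_1: "rho l 1 = \<one>\<^bsub>RR l\<^esub>"
  using ring_hom_one[OF rho_hom] by simp

lemma rho_surj: "c \<in> carrier (RR l) \<Longrightarrow> \<exists>x\<in>\<O>. c = rho l x"
  by (auto simp: RR_def FactRing_def A_RCOSETS_def' rho_def)

text \<open>Halving in the complex numbers turns equality of cosets into integrality of an explicit
  number, so that the lattices below can be described without cosets.\<close>

lemma rho_eq_iff: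
  assumes "x \<in> \<O>" "y \<in> \<O>"
  shows "rho l x = rho l y \<longleftrightarrow> (x - y) / 2 \<in> \<O>"
proof
  assume "rho l x = rho l y"
  moreover have "x \<in> rho l x" unfolding rho_def' by force
  ultimately obtain w where "w \<in> \<O>" "x = 2 * w + y" by (auto simp: rho_def')
  then show "(x - y) / 2 \<in> \<O>" by simp
next
  assume w: "(x - y) / 2 \<in> \<O>"
  have "2 * ((x - y) / 2) + y = x" by (simp add: field_simps)
  then have "rho l x = rho l (2 * ((x - y) / 2) + y)" by (simp only:)
  also have "\<dots> = rho l 2 \<otimes>\<^bsub>RR l\<^esub> rho l ((x - y) / 2) \<oplus>\<^bsub>RR l\<^esub> rho l y"
    using w assms by (simp only: rho_add rho_mult OK_mult OK_numerals)
  \<comment> \<open>As sets, the cosets of 2 and 0 agree after shifting the multiplier of 2 by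
    1.\<close>
  also have "rho l 2 = \<zero>\<^bsub>RR l\<^esub>"
  proof -
    have "rho l 2 = rho l 0"
    proof (intro equalityI subsetI)
      fix z assume "z \<in> rho l 2"
      then obtain v where "v \<in> \<O>" "z = 2 * v + 2" by (auto simp: rho_def')
      then have "v + 1 \<in> \<O>" "z = 2 * (v + 1) + 0" by simp_all
      then show "z \<in> rho l 0" unfolding rho_def' by blast
    next
      fix z assume "z \<in> rho l 0"
      then obtain v where "v \<in> \<O>" "z = 2 * v" by (auto simp: rho_def')
      then have "v - 1 \<in> \<O>" "z = 2 * (v - 1) + 2" by simp_all
      then show "z \<in> rho l 2" unfolding rho_def' by blast
    qed
    then show ?thesis by (simp add: rho_0)
  qed
  finally show "rho l x = rho l y" using w assms by simp
qed

lemma rho_eq_0_iff: "x \<in> \<O> \<Longrightarrow> rho l x = \<zero>\<^bsub>RR l\<^esub> \<longleftrightarrow> x / 2 \<in> \<O>"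
  using rho_eq_iff[of x 0] by (simp add: rho_0)

lemma RR_double [simp]:
  assumes "c \<in> carrier (RR l)" shows "c \<oplus>\<^bsub>RR l\<^esub> c = \<zero>\<^bsub>RR l\<^esub>"
proof -
  obtain x where x: "x \<in> \<O>" "c = rho l x" using rho_surj assms by blast
  then have "c \<oplus>\<^bsub>RR l\<^esub> c = rho l (x + x)" by (simp only: rho_add)
  also have "\<dots> = \<zero>\<^bsub>RR l\<^esub>" using x by (subst rho_eq_0_iff) simp_all
  finally show ?thesis .
qed

lemma RR_add_eq_0_iff:
  assumes "c \<in> carrier (RR l)" "d \<in> carrier (RR l)"
  shows "c \<oplus>\<^bsub>RR l\<^esub> d = \<zero>\<^bsub>RR l\<^esub> \<longleftrightarrow> c = d"
  by (metis assms RR_double R.add.inv_unique' R.minus_equality)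

lemma e_closed: "e \<in> carrier (RR l)" and f_closed: "f \<in> carrier (RR l)"
  by simp_all

text \<open>In characteristic 2 this is \<open>e^2 + e = 0\<close>, which holds because (l + 1)/4 is
  even for l = 7 modulo 8.\<close>

lemma e_idem: "e \<otimes>\<^bsub>RR l\<^esub> e = e"
  using residue_ring(5)[OF pos sf l7] by (simp add: RR_add_eq_0_iff)

lemma e_f: "e \<otimes>\<^bsub>RR l\<^esub> f = \<zero>\<^bsub>RR l\<^esub>"
  by (simp add: R.r_distr e_idem)

lemma f_e: "f \<otimes>\<^bsub>RR l\<^esub> e = \<zero>\<^bsub>RR l\<^esub>"
  by (simp add: R.l_distr e_idem)

text \<open>Since \<open>f = e + 1\<close>, two copies of \<open>e c\<close> cancel. This splitting
  along the idempotents rebuilds a codeword from its two parts.\<close>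

lemma e_plus_f:
  assumes "c \<in> carrier (RR l)"
  shows "e \<otimes>\<^bsub>RR l\<^esub> c \<oplus>\<^bsub>RR l\<^esub> f \<otimes>\<^bsub>RR l\<^esub> c = c"
proof -
  have "e \<otimes>\<^bsub>RR l\<^esub> c \<oplus>\<^bsub>RR l\<^esub> f \<otimes>\<^bsub>RR l\<^esub> c = (e \<otimes>\<^bsub>RR l\<^esub> c \<oplus>\<^bsub>RR l\<^esub> e \<otimes>\<^bsub>RR l\<^esub> c) \<oplus>\<^bsub>RR l\<^esub> c"
    \<comment> \<open>\<open>RR_double\<close> is withheld so that both sides reach the same
      right-nested sum before anything cancels.\<close>
    using assms by (simp add: R.l_distr R.a_assoc del: RR_double)
  then show ?thesis using assms by simp
qed

text \<open>The conjugate of \<open>omega l\<close> is \<open>- 1 - omega l\<close>, and signs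
  disappear modulo 2. Hence multiplication by \<open>f\<close> lifts to multiplication by the
  conjugate.\<close>

lemma rho_cnj_omega: "rho l (cnj (omega l)) = f"
proof -
  have "f = rho l (omega l + 1)" by (simp add: rho_add rho_1)
  also have "\<dots> = rho l (cnj (omega l))"
    by (subst rho_eq_iff) (simp_all add: cnj_omega[OF pos] add_divide_distrib)
  finally show ?thesis ..
qed

text \<open>The four listed residues exhaust a ring with four elements, so a coincidence among them
  would leave at most three.\<close>

lemma nonzero: "e \<noteq> \<zero>\<^bsub>RR l\<^esub>" "f \<noteq> \<zero>\<^bsub>RR l\<^esub>" "\<one>\<^bsub>RR l\<^esub> \<noteq> \<zero>\<^bsub>RR l\<^esub>"
proof -
  have c: "card {\<zero>\<^bsub>RR l\<^esub>, \<one>\<^bsub>RR l\<^esub>, e, f} = 4"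
    using residue_ring(3,4)[OF pos sf l7] by simp
  have "card {x, y, z} < 4" for x y z :: "complex set"
    using card_length[of "[x, y, z]"] by simp
  with c show "e \<noteq> \<zero>\<^bsub>RR l\<^esub>" "f \<noteq> \<zero>\<^bsub>RR l\<^esub>" "\<one>\<^bsub>RR l\<^esub> \<noteq> \<zero>\<^bsub>RR l\<^esub>"
    by (metis insert_absorb2 insert_commute nat_neq_iff)+
qed

section \<open>Conjugation, duality and coordinatewise descriptions of the codes\<close>

lemma conjR_closed [simp]:
  assumes "c \<in> carrier (RR l)" shows "conjR c \<in> carrier (RR l)"
proof -
  obtain x where x: "x \<in> \<O>" "c = rho l x" using rho_surj assms by blast
  then obtain a b where "x = of_int a + of_int b * omega l" unfolding OK_iff by blast
  then have "cnj x = of_int a + of_int b * cnj (omega l)" by simp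
  then have "cnj x \<in> \<O>" by simp
  then show ?thesis by (simp add: x conjR_rho[OF pos])
qed

lemma conjR_0_1 [simp]: "conjR \<zero>\<^bsub>RR l\<^esub> = \<zero>\<^bsub>RR l\<^esub>" "conjR \<one>\<^bsub>RR l\<^esub> = \<one>\<^bsub>RR l\<^esub>"
  by (simp_all add: conjR_rho[OF pos] flip: rho_0 rho_1)

lemma orthogonal_eq:
  assumes "v \<in> vecs n (carrier (RR l))" "y \<in> vecs n (carrier (RR l))" "d \<in> carrier (RR l)"
  shows "(\<Oplus>\<^bsub>RR l\<^esub>i\<in>{..<n}. y i \<otimes>\<^bsub>RR l\<^esub> conjR (smult_vec l n d v i)) =
    (\<Oplus>\<^bsub>RR l\<^esub>i\<in>{..<n}. y i \<otimes>\<^bsub>RR l\<^esub> conjR (d \<otimes>\<^bsub>RR l\<^esub> v i))"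
  using assms by (intro R.finsum_cong') (auto simp: smult_vec_def vecs_def PiE_iff)

lemma comb_codeI:
  assumes w: "w \<in> vecs n (carrier (RR l))" and v: "v \<in> vecs n (carrier (RR l))"
    and c: "c \<in> carrier (RR l)" and y: "y \<in> vecs n (carrier (RR l))"
    and orth: "\<And>d. d \<in> carrier (RR l) \<Longrightarrow>
      (\<Oplus>\<^bsub>RR l\<^esub>i\<in>{..<n}. y i \<otimes>\<^bsub>RR l\<^esub> conjR (d \<otimes>\<^bsub>RR l\<^esub> v i)) = \<zero>\<^bsub>RR l\<^esub>"
    and eq: "\<And>i. i < n \<Longrightarrow> a1 \<otimes>\<^bsub>RR l\<^esub> (c \<otimes>\<^bsub>RR l\<^esub> v i) \<oplus>\<^bsub>RR l\<^esub> a2 \<otimes>\<^bsub>RR l\<^esub> y i = w i"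
  shows "w \<in> comb_code l n a1 a2 v"
proof -
  have "y \<in> dual_code l n (gen_code l n v)"
    using y orth by (auto simp: dual_code_def gen_code_def orthogonal_eq[OF v])
  moreover have "smult_vec l n c v \<in> gen_code l n v"
    using c by (auto simp: gen_code_def)
  \<comment> \<open>Compared pointwise: from index \<open>n\<close> on both sides are
    \<open>undefined\<close>, so \<open>eq\<close> is needed only below \<open>n\<close>.\<close>
  moreover have "w = add_vec l n (smult_vec l n a1 (smult_vec l n c v)) (smult_vec l n a2 y)"
  proof
    fix i
    show "w i = add_vec l n (smult_vec l n a1 (smult_vec l n c v)) (smult_vec l n a2 y) i"
      using w eq[of i] by (auto simp: add_vec_def smult_vec_def vecs_def PiE_iff extensional_def)
  qed
  ultimately show ?thesis unfolding comb_code_def by blast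
qed

text \<open>Of the orthogonality to all multiples of \<open>v\<close>, only the multiple by 1 is
  kept. The factor 1 stays visible so that the evaluations \<open>orth\<close> below apply with
  \<open>d\<close> equal to 1.\<close>

lemma comb_codeE:
  assumes w: "w \<in> comb_code l n a1 a2 v"
    and v: "v \<in> vecs n (carrier (RR l))"
    and a: "a1 \<in> carrier (RR l)" "a2 \<in> carrier (RR l)"
  obtains c y where "w \<in> vecs n (carrier (RR l))" "c \<in> carrier (RR l)" "y \<in> vecs n (carrier (RR l))"
    "(\<Oplus>\<^bsub>RR l\<^esub>i\<in>{..<n}. y i \<otimes>\<^bsub>RR l\<^esub> conjR (\<one>\<^bsub>RR l\<^esub> \<otimes>\<^bsub>RR l\<^esub> v i)) = \<zero>\<^bsub>RR l\<^esub>"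
    "\<And>i. i < n \<Longrightarrow> w i = a1 \<otimes>\<^bsub>RR l\<^esub> (c \<otimes>\<^bsub>RR l\<^esub> v i) \<oplus>\<^bsub>RR l\<^esub> a2 \<otimes>\<^bsub>RR l\<^esub> y i"
proof -
  have wv: "w \<in> vecs n (carrier (RR l))"
    using comb_code_finite(1)[OF pos sf l7 a v] w by blast
  obtain c y where c: "c \<in> carrier (RR l)" and y: "y \<in> dual_code l n (gen_code l n v)"
    and eq: "w = add_vec l n (smult_vec l n a1 (smult_vec l n c v)) (smult_vec l n a2 y)"
    using w by (auto simp: comb_code_def gen_code_def)
  have yv: "y \<in> vecs n (carrier (RR l))" using y by (simp add: dual_code_def)
  have "smult_vec l n \<one>\<^bsub>RR l\<^esub> v \<in> gen_code l n v" by (auto simp: gen_code_def)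
  then have "(\<Oplus>\<^bsub>RR l\<^esub>i\<in>{..<n}. y i \<otimes>\<^bsub>RR l\<^esub> conjR (\<one>\<^bsub>RR l\<^esub> \<otimes>\<^bsub>RR l\<^esub> v i)) = \<zero>\<^bsub>RR l\<^esub>"
    using y by (simp add: dual_code_def flip: orthogonal_eq[OF v yv])
  then show ?thesis
    by (rule that[OF wv c yv]) (simp add: eq add_vec_def smult_vec_def)
qed

lemma finsum_last_two:
  assumes "g \<in> {..<Suc (Suc m)} \<rightarrow> carrier (RR l)" "\<And>i. i < m \<Longrightarrow> g i = \<zero>\<^bsub>RR l\<^esub>"
  shows "(\<Oplus>\<^bsub>RR l\<^esub>i\<in>{..<Suc (Suc m)}. g i) = g (Suc m) \<oplus>\<^bsub>RR l\<^esub> g m"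
proof -
  have "(\<Oplus>\<^bsub>RR l\<^esub>i\<in>{..<m}. g i) = \<zero>\<^bsub>RR l\<^esub>"
    using assms by (intro R.add.finprod_one_eqI) auto
  moreover have "g \<in> {..<m} \<rightarrow> carrier (RR l)" "g m \<in> carrier (RR l)" "g (Suc m) \<in> carrier (RR l)"
    using assms(1) by auto
  ultimately show ?thesis
    by (simp add: lessThan_Suc R.finsum_insert Pi_iff)
qed

text \<open>Orthogonality to the generator makes the last two entries of the dual word sum to 0,
  hence equal in characteristic 2; so the last two entries of \<open>w\<close> agree. Every other
  entry of \<open>w\<close> is a multiple of \<open>f\<close>, which \<open>e\<close> kills.\<close>

lemma code1_eq:
  "code1 l (Suc (Suc m)) = {w \<in> vecs (Suc (Suc m)) (carrier (RR l)).
     (\<forall>i<m. e \<otimes>\<^bsub>RR l\<^esub> w i = \<zero>\<^bsub>RR l\<^esub>) \<and> w m = w (Suc m)}"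
proof -
  let ?n = "Suc (Suc m)"
  have v: "vec1 l ?n \<in> vecs ?n (carrier (RR l))"
    by (auto simp: vec1_def vecs_def)
  have v0: "vec1 l ?n i = \<zero>\<^bsub>RR l\<^esub>" if "i < m" for i
    using that by (simp add: vec1_def)
  have v1: "vec1 l ?n m = \<one>\<^bsub>RR l\<^esub>" "vec1 l ?n (Suc m) = \<one>\<^bsub>RR l\<^esub>"
    by (simp_all add: vec1_def)
  have orth: "(\<Oplus>\<^bsub>RR l\<^esub>i\<in>{..<?n}. y i \<otimes>\<^bsub>RR l\<^esub> conjR (d \<otimes>\<^bsub>RR l\<^esub> vec1 l ?n i)) =
      y (Suc m) \<otimes>\<^bsub>RR l\<^esub> conjR d \<oplus>\<^bsub>RR l\<^esub> y m \<otimes>\<^bsub>RR l\<^esub> conjR d"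
    if "y \<in> vecs ?n (carrier (RR l))" "d \<in> carrier (RR l)" for y d
    using that v by (subst finsum_last_two) (auto simp: v0 v1 vecs_def PiE_iff)
  show ?thesis
  proof (intro equalityI subsetI)
    fix w assume "w \<in> code1 l ?n"
    then have "w \<in> comb_code l ?n e f (vec1 l ?n)" by (simp add: code1_def)
    then obtain c y where w: "w \<in> vecs ?n (carrier (RR l))" and c: "c \<in> carrier (RR l)"
      and y: "y \<in> vecs ?n (carrier (RR l))"
      and o: "(\<Oplus>\<^bsub>RR l\<^esub>i\<in>{..<?n}. y i \<otimes>\<^bsub>RR l\<^esub> conjR (\<one>\<^bsub>RR l\<^esub> \<otimes>\<^bsub>RR l\<^esub> vec1 l ?n i)) = \<zero>\<^bsub>RR l\<^esub>"
      and eq: "\<And>i. i < ?n \<Longrightarrow>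
        w i = e \<otimes>\<^bsub>RR l\<^esub> (c \<otimes>\<^bsub>RR l\<^esub> vec1 l ?n i) \<oplus>\<^bsub>RR l\<^esub> f \<otimes>\<^bsub>RR l\<^esub> y i"
      by (rule comb_codeE[OF _ v e_closed f_closed]) blast
    have yc: "y i \<in> carrier (RR l)" if "i < ?n" for i
      using y that by (auto simp: vecs_def)
    have "y (Suc m) = y m"
      using o orth[OF y R.one_closed] by (simp add: yc RR_add_eq_0_iff)
    then have "w m = w (Suc m)" by (simp add: eq v1)
    moreover have "e \<otimes>\<^bsub>RR l\<^esub> w i = \<zero>\<^bsub>RR l\<^esub>" if "i < m" for i
    proof -
      have "w i = f \<otimes>\<^bsub>RR l\<^esub> y i" using that c by (simp add: eq v0 yc)
      then show ?thesis
        using that by (simp add: yc e_f flip: R.m_assoc)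
    qed
    ultimately show "w \<in> {w \<in> vecs ?n (carrier (RR l)).
      (\<forall>i<m. e \<otimes>\<^bsub>RR l\<^esub> w i = \<zero>\<^bsub>RR l\<^esub>) \<and> w m = w (Suc m)}" using w by simp
  next
    fix w assume "w \<in> {w \<in> vecs ?n (carrier (RR l)).
      (\<forall>i<m. e \<otimes>\<^bsub>RR l\<^esub> w i = \<zero>\<^bsub>RR l\<^esub>) \<and> w m = w (Suc m)}"
    then have w: "w \<in> vecs ?n (carrier (RR l))" and w0: "\<And>i. i < m \<Longrightarrow> e \<otimes>\<^bsub>RR l\<^esub> w i = \<zero>\<^bsub>RR l\<^esub>"
      and w1: "w m = w (Suc m)" by auto
    have wc: "w i \<in> carrier (RR l)" if "i < ?n" for i
      using w that by (auto simp: vecs_def)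
    show "w \<in> code1 l ?n"
      unfolding code1_def
    \<comment> \<open>The word \<open>w\<close> serves as its own dual word, since its last two
      entries agree. The scalar is an entry of \<open>w\<close>, and the first \<open>show\<close>
      selects the last one.\<close>
    proof (rule comb_codeI[OF w v wc w])
      show "Suc m < ?n" by simp
      show "(\<Oplus>\<^bsub>RR l\<^esub>i\<in>{..<?n}. w i \<otimes>\<^bsub>RR l\<^esub> conjR (d \<otimes>\<^bsub>RR l\<^esub> vec1 l ?n i)) = \<zero>\<^bsub>RR l\<^esub>"
        if "d \<in> carrier (RR l)" for d
        using that by (simp add: orth[OF w that] w1 wc)
      fix i assume i: "i < ?n"
      consider "i < m" | "i = m" | "i = Suc m" using i by linarith
      then show "e \<otimes>\<^bsub>RR l\<^esub> (w (Suc m) \<otimes>\<^bsub>RR l\<^esub> vec1 l ?n i) \<oplus>\<^bsub>RR l\<^esub> f \<otimes>\<^bsub>RR l\<^esub> w i = w i"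
      proof cases
        case 1
        then show ?thesis
          using e_plus_f[OF wc[OF i]] wc[OF i] by (simp add: v0 w0 wc)
      qed (simp_all add: v1 w1 wc e_plus_f)
    qed
  qed
qed

text \<open>Orthogonality now forces the last entry of the dual word to vanish, so the last entry of
  \<open>w\<close> is a multiple of \<open>e\<close>. Only one coordinate is special, hence the
  length \<open>Suc m\<close>.\<close>

lemma code2_eq:
  "code2 l (Suc m) = {w \<in> vecs (Suc m) (carrier (RR l)).
     (\<forall>i<m. e \<otimes>\<^bsub>RR l\<^esub> w i = \<zero>\<^bsub>RR l\<^esub>) \<and> f \<otimes>\<^bsub>RR l\<^esub> w m = \<zero>\<^bsub>RR l\<^esub>}"
proof -
  let ?n = "Suc m"
  have v: "vec2 l ?n \<in> vecs ?n (carrier (RR l))"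
    by (auto simp: vec2_def vecs_def)
  have v0: "vec2 l ?n i = \<zero>\<^bsub>RR l\<^esub>" if "i < m" for i
    using that by (simp add: vec2_def)
  have v1: "vec2 l ?n m = \<one>\<^bsub>RR l\<^esub>"
    by (simp add: vec2_def)
  have orth: "(\<Oplus>\<^bsub>RR l\<^esub>i\<in>{..<?n}. y i \<otimes>\<^bsub>RR l\<^esub> conjR (d \<otimes>\<^bsub>RR l\<^esub> vec2 l ?n i)) =
      y m \<otimes>\<^bsub>RR l\<^esub> conjR d"
    if y: "y \<in> vecs ?n (carrier (RR l))" and d: "d \<in> carrier (RR l)" for y d
  proof -
    let ?g = "\<lambda>i. y i \<otimes>\<^bsub>RR l\<^esub> conjR (d \<otimes>\<^bsub>RR l\<^esub> vec2 l ?n i)"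
    have yc: "y i \<in> carrier (RR l)" if "i < ?n" for i
      using y that by (auto simp: vecs_def)
    have z: "?g i = \<zero>\<^bsub>RR l\<^esub>" if "i < m" for i
      using that d by (simp add: v0 yc)
    have "(\<Oplus>\<^bsub>RR l\<^esub>i\<in>{..<m}. ?g i) = \<zero>\<^bsub>RR l\<^esub>"
      using z by (intro R.add.finprod_one_eqI) auto
    then show ?thesis
      using d by (simp add: lessThan_Suc R.finsum_insert Pi_iff z v1 yc)
  qed
  show ?thesis
  proof (intro equalityI subsetI)
    fix w assume "w \<in> code2 l ?n"
    then have "w \<in> comb_code l ?n e f (vec2 l ?n)" by (simp add: code2_def)
    then obtain c y where w: "w \<in> vecs ?n (carrier (RR l))" and c: "c \<in> carrier (RR l)"
      and y: "y \<in> vecs ?n (carrier (RR l))"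
      and o: "(\<Oplus>\<^bsub>RR l\<^esub>i\<in>{..<?n}. y i \<otimes>\<^bsub>RR l\<^esub> conjR (\<one>\<^bsub>RR l\<^esub> \<otimes>\<^bsub>RR l\<^esub> vec2 l ?n i)) = \<zero>\<^bsub>RR l\<^esub>"
      and eq: "\<And>i. i < ?n \<Longrightarrow>
        w i = e \<otimes>\<^bsub>RR l\<^esub> (c \<otimes>\<^bsub>RR l\<^esub> vec2 l ?n i) \<oplus>\<^bsub>RR l\<^esub> f \<otimes>\<^bsub>RR l\<^esub> y i"
      by (rule comb_codeE[OF _ v e_closed f_closed]) blast
    have yc: "y i \<in> carrier (RR l)" if "i < ?n" for i
      using y that by (auto simp: vecs_def)
    have "y m = \<zero>\<^bsub>RR l\<^esub>"
      using o orth[OF y R.one_closed] by (simp add: yc)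
    then have "w m = e \<otimes>\<^bsub>RR l\<^esub> c" using c by (simp add: eq v1)
    then have "f \<otimes>\<^bsub>RR l\<^esub> w m = \<zero>\<^bsub>RR l\<^esub>"
      using c by (simp add: f_e flip: R.m_assoc)
    moreover have "e \<otimes>\<^bsub>RR l\<^esub> w i = \<zero>\<^bsub>RR l\<^esub>" if "i < m" for i
    proof -
      have "w i = f \<otimes>\<^bsub>RR l\<^esub> y i" using that c by (simp add: eq v0 yc)
      then show ?thesis
        using that by (simp add: yc e_f flip: R.m_assoc)
    qed
    ultimately show "w \<in> {w \<in> vecs ?n (carrier (RR l)).
      (\<forall>i<m. e \<otimes>\<^bsub>RR l\<^esub> w i = \<zero>\<^bsub>RR l\<^esub>) \<and> f \<otimes>\<^bsub>RR l\<^esub> w m = \<zero>\<^bsub>RR l\<^esub>}" using w by simp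
  next
    fix w assume "w \<in> {w \<in> vecs ?n (carrier (RR l)).
      (\<forall>i<m. e \<otimes>\<^bsub>RR l\<^esub> w i = \<zero>\<^bsub>RR l\<^esub>) \<and> f \<otimes>\<^bsub>RR l\<^esub> w m = \<zero>\<^bsub>RR l\<^esub>}"
    then have w: "w \<in> vecs ?n (carrier (RR l))" and w0: "\<And>i. i < m \<Longrightarrow> e \<otimes>\<^bsub>RR l\<^esub> w i = \<zero>\<^bsub>RR l\<^esub>"
      and w1: "f \<otimes>\<^bsub>RR l\<^esub> w m = \<zero>\<^bsub>RR l\<^esub>" by auto
    have wc: "w i \<in> carrier (RR l)" if "i < ?n" for i
      using w that by (auto simp: vecs_def)
    \<comment> \<open>The word \<open>w\<close> need not be orthogonal to the generator; clearing
      its last entry makes it so. The scalar \<open>w m\<close> restores that entry, because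
      \<open>f\<close> kills \<open>w m\<close>.\<close>
    define y where "y = w(m := \<zero>\<^bsub>RR l\<^esub>)"
    have y: "y \<in> vecs ?n (carrier (RR l))"
      using w by (auto simp: y_def vecs_def PiE_iff extensional_def)
    show "w \<in> code2 l ?n"
      unfolding code2_def
    proof (rule comb_codeI[OF w v wc y])
      show "m < ?n" by simp
      show "(\<Oplus>\<^bsub>RR l\<^esub>i\<in>{..<?n}. y i \<otimes>\<^bsub>RR l\<^esub> conjR (d \<otimes>\<^bsub>RR l\<^esub> vec2 l ?n i)) = \<zero>\<^bsub>RR l\<^esub>"
        if "d \<in> carrier (RR l)" for d
        using that by (simp add: orth[OF y that]) (simp add: y_def)
      fix i assume i: "i < ?n"
      have s: "e \<otimes>\<^bsub>RR l\<^esub> w i \<oplus>\<^bsub>RR l\<^esub> f \<otimes>\<^bsub>RR l\<^esub> w i = w i" by (rule e_plus_f[OF wc[OF i]])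
      show "e \<otimes>\<^bsub>RR l\<^esub> (w m \<otimes>\<^bsub>RR l\<^esub> vec2 l ?n i) \<oplus>\<^bsub>RR l\<^esub> f \<otimes>\<^bsub>RR l\<^esub> y i = w i"
      proof (cases "i = m")
        case True
        then show ?thesis using s by (simp add: y_def v1 wc w1)
      next
        case False
        then have "i < m" using i by simp
        then show ?thesis using s by (simp add: y_def v0 wc w0)
      qed
    qed
  qed
qed

section \<open>Comparison of the weight enumerators\<close>

definition monomial_exponent :: "nat \<Rightarrow> (nat \<Rightarrow> complex set) \<Rightarrow> nat \<Rightarrow>\<^sub>0 nat" where
  "monomial_exponent n u = Poly_Mapping.single 0 (ncoord n \<zero>\<^bsub>RR l\<^esub> u) +
     Poly_Mapping.single 1 (ncoord n \<one>\<^bsub>RR l\<^esub> u) + Poly_Mapping.single 2 (ncoord n e u + ncoord n f u)"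

lemma lookup_monomial_exponent:
  "Poly_Mapping.lookup (monomial_exponent n u) 1 = ncoord n \<one>\<^bsub>RR l\<^esub> u"
  by (simp add: monomial_exponent_def lookup_add lookup_single)

text \<open>Each word contributes one monomial with coefficient 1, so coefficients count words and
  cannot cancel.\<close>

lemma lookup_swe:
  "Poly_Mapping.lookup (swe l n C) t = (\<Sum>u\<in>C. if t = monomial_exponent n u then 1 else 0)"
proof -
  have "swe l n C = (\<Sum>u\<in>C. Poly_Mapping.single (monomial_exponent n u) 1)"
    by (simp add: swe_def mvar_power mult_single monomial_exponent_def)
  then show ?thesis
    by (simp add: lookup_sum lookup_single when_def)
qed

lemma swe_code_neq:
  "swe l (Suc (Suc m)) (code1 l (Suc (Suc m))) \<noteq> swe l (Suc (Suc m)) (code2 l (Suc (Suc m)))"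
proof -
  let ?n = "Suc (Suc m)"
  define w :: "nat \<Rightarrow> complex set" where
    "w = (\<lambda>i\<in>{..<?n}. if i < m then \<zero>\<^bsub>RR l\<^esub> else \<one>\<^bsub>RR l\<^esub>)"
  have w: "w \<in> code1 l ?n"
    unfolding code1_eq by (auto simp: w_def vecs_def)
  \<comment> \<open>Finiteness matters because a sum over an infinite set is 0 by default.\<close>
  have "finite (carrier (RR l))"
    unfolding residue_ring(3)[OF pos sf l7] by simp
  then have fin: "finite (vecs ?n (carrier (RR l)))"
    by (auto simp: vecs_def intro: finite_PiE)
  have fin1: "finite (code1 l ?n)" and fin2: "finite (code2 l ?n)"
    unfolding code1_eq code2_eq using fin by simp_all
  have "ncoord ?n \<one>\<^bsub>RR l\<^esub> u = 0" if "u \<in> code2 l ?n" for u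
  proof -
    have "u i \<noteq> \<one>\<^bsub>RR l\<^esub>" if "i < ?n" for i
    proof
      assume "u i = \<one>\<^bsub>RR l\<^esub>"
      \<comment> \<open>If the entry were 1, then \<open>e\<close> or \<open>f\<close> itself would
        vanish.\<close>
      moreover have "e \<otimes>\<^bsub>RR l\<^esub> u i = \<zero>\<^bsub>RR l\<^esub> \<or> f \<otimes>\<^bsub>RR l\<^esub> u i = \<zero>\<^bsub>RR l\<^esub>"
        using \<open>u \<in> code2 l ?n\<close> \<open>i < ?n\<close> unfolding code2_eq by (cases "i = Suc m") auto
      ultimately show False
        using nonzero R.r_one[OF e_closed] R.r_one[OF f_closed] by simp
    qed
    then show ?thesis by (auto simp: ncoord_def)
  qed
  moreover have "ncoord ?n \<one>\<^bsub>RR l\<^esub> w \<noteq> 0"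
  proof -
    have "m \<in> {i. i < ?n \<and> w i = \<one>\<^bsub>RR l\<^esub>}" by (simp add: w_def)
    moreover have "finite {i. i < ?n \<and> w i = \<one>\<^bsub>RR l\<^esub>}" by simp
    ultimately show ?thesis unfolding ncoord_def by (metis card_0_eq empty_iff)
  qed
  \<comment> \<open>The exponent of Y alone separates the monomials.\<close>
  ultimately have ne: "monomial_exponent ?n w \<noteq> monomial_exponent ?n u" if "u \<in> code2 l ?n" for u
    using that by (metis lookup_monomial_exponent)
  have "Poly_Mapping.lookup (swe l ?n (code2 l ?n)) (monomial_exponent ?n w) = 0"
    unfolding lookup_swe by (rule sum.neutral) (simp add: ne)
  moreover have "Poly_Mapping.lookup (swe l ?n (code1 l ?n)) (monomial_exponent ?n w) > 0"
    unfolding lookup_swe by (rule sum_pos2[OF fin1 w]) simp_all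
  ultimately show ?thesis by auto
qed

section \<open>The lattices of Construction A\<close>

lemma ann_e_iff: "x \<in> \<O> \<Longrightarrow> e \<otimes>\<^bsub>RR l\<^esub> rho l x = \<zero>\<^bsub>RR l\<^esub> \<longleftrightarrow> omega l * x / 2 \<in> \<O>"
  using rho_eq_0_iff[of "omega l * x"] by (simp add: rho_mult)

lemma ann_f_iff: "x \<in> \<O> \<Longrightarrow> f \<otimes>\<^bsub>RR l\<^esub> rho l x = \<zero>\<^bsub>RR l\<^esub> \<longleftrightarrow> cnj (omega l) * x / 2 \<in> \<O>"
  using rho_eq_0_iff[of "cnj (omega l) * x"]
  by (simp add: rho_mult rho_cnj_omega del: complex_cnj_mult)

lemma constrA_code1:
  "constrA l (Suc (Suc m)) (code1 l (Suc (Suc m))) = {z \<in> vecs (Suc (Suc m)) \<O>.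
     (\<forall>i<m. omega l * z i / 2 \<in> \<O>) \<and> (z m - z (Suc m)) / 2 \<in> \<O>}"
proof -
  have "z i \<in> \<O>" if "z \<in> vecs (Suc (Suc m)) \<O>" "i < Suc (Suc m)" for z i
    using that by (auto simp: vecs_def)
  then show ?thesis
    unfolding constrA_def code1_eq
    by (intro Collect_cong conj_cong refl)
      (auto simp: ann_e_iff rho_eq_iff vecs_def)
qed

lemma constrA_code2:
  "constrA l (Suc m) (code2 l (Suc m)) = {z \<in> vecs (Suc m) \<O>.
     (\<forall>i<m. omega l * z i / 2 \<in> \<O>) \<and> cnj (omega l) * z m / 2 \<in> \<O>}"
proof -
  have "z i \<in> \<O>" if "z \<in> vecs (Suc m) \<O>" "i < Suc m" for z i
    using that by (auto simp: vecs_def)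
  then show ?thesis
    unfolding constrA_def code2_eq
    by (intro Collect_cong conj_cong refl)
      (auto simp: ann_e_iff ann_f_iff vecs_def)
qed

section \<open>Equality of the theta series at level 7\<close>

text \<open>The hypothesis amounts to l = 7, in the form that makes \<phi> an isometry from the
  second lattice onto the first, fixing all coordinates but the last two.\<close>

lemma theta_code_eq:
  assumes norm: "omega l * cnj (omega l) = 2"
  shows "theta (Suc (Suc m)) (constrA l (Suc (Suc m)) (code1 l (Suc (Suc m)))) =
    theta (Suc (Suc m)) (constrA l (Suc (Suc m)) (code2 l (Suc (Suc m))))"
proof -
  let ?n = "Suc (Suc m)"
  let ?w = "omega l" and ?w' = "cnj (omega l)"
  let ?L1 = "constrA l ?n (code1 l ?n)" and ?L2 = "constrA l ?n (code2 l ?n)"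
  have norm': "?w * (?w' * x) = 2 * x" "?w' * (?w * x) = 2 * x" for x
    using norm by (metis mult.assoc, metis mult.assoc mult.commute)
  \<comment> \<open>With a = \<omega> z_m / 2 and b = \<omega>' z_(m+1) / 2, where \<omega>' is the
    conjugate, the new entries are a + b and a - b. Since \<omega> \<omega>' = 2, the old entries
    are \<omega>' a and \<omega> b.\<close>
  define \<phi> where "\<phi> z = z(m := (?w * z m + ?w' * z (Suc m)) / 2,
      Suc m := (?w * z m - ?w' * z (Suc m)) / 2)" for z :: "nat \<Rightarrow> complex"
  \<comment> \<open>The inverse recovers a and b as half sum and half difference, then multiplies
    them by \<omega>' and \<omega>.\<close>
  define \<psi> where "\<psi> z = z(m := ?w' * ((z m + z (Suc m)) / 2),
      Suc m := ?w * ((z m - z (Suc m)) / 2))" for z :: "nat \<Rightarrow> complex"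
  have \<psi>\<phi>: "\<psi> (\<phi> z) = z" for z
  proof
    fix i
    show "\<psi> (\<phi> z) i = z i"
      by (simp add: \<psi>_def \<phi>_def add_divide_distrib diff_divide_distrib norm')
  qed
  have \<phi>\<psi>: "\<phi> (\<psi> z) = z" for z
  proof
    fix i
    show "\<phi> (\<psi> z) i = z i"
      by (simp add: \<psi>_def \<phi>_def norm' add_divide_distrib diff_divide_distrib)
  qed
  have \<phi>_mem: "\<phi> z \<in> ?L1" if "z \<in> ?L2" for z
  proof -
    have z: "z \<in> vecs ?n \<O>" and a: "\<And>i. i < Suc m \<Longrightarrow> ?w * z i / 2 \<in> \<O>"
      and b: "?w' * z (Suc m) / 2 \<in> \<O>"
      using that unfolding constrA_code2 by auto
    have "(?w * z m + ?w' * z (Suc m)) / 2 \<in> \<O>" "(?w * z m - ?w' * z (Suc m)) / 2 \<in> \<O>"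
      using a[of m] b by (simp_all add: add_divide_distrib diff_divide_distrib)
    then have "\<phi> z \<in> vecs ?n \<O>"
      using z by (auto simp: \<phi>_def vecs_def PiE_iff extensional_def)
    moreover have "(\<phi> z m - \<phi> z (Suc m)) / 2 = ?w' * z (Suc m) / 2"
      by (simp add: \<phi>_def field_simps)
    then have "(\<phi> z m - \<phi> z (Suc m)) / 2 \<in> \<O>"
      using b by (simp only:)
    moreover have "?w * \<phi> z i / 2 \<in> \<O>" if "i < m" for i
      using a[of i] that by (simp add: \<phi>_def)
    ultimately show ?thesis
      unfolding constrA_code1 by blast
  qed
  have \<psi>_mem: "\<psi> z \<in> ?L2" if "z \<in> ?L1" for z
  proof -
    have z: "z \<in> vecs ?n \<O>" and a: "\<And>i. i < m \<Longrightarrow> ?w * z i / 2 \<in> \<O>"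
      and b: "(z m - z (Suc m)) / 2 \<in> \<O>"
      using that unfolding constrA_code1 by auto
    have "z (Suc m) \<in> \<O>" using z by (auto simp: vecs_def)
    \<comment> \<open>The half sum exceeds the half difference by the integral entry
      \<open>z (Suc m)\<close>.\<close>
    with b have "(z m - z (Suc m)) / 2 + z (Suc m) \<in> \<O>" by (rule OK_add)
    also have "(z m - z (Suc m)) / 2 + z (Suc m) = (z m + z (Suc m)) / 2"
      by (simp add: field_simps)
    finally have c: "(z m + z (Suc m)) / 2 \<in> \<O>" .
    have "\<psi> z \<in> vecs ?n \<O>"
      using z b c by (auto simp: \<psi>_def vecs_def PiE_iff extensional_def simp del: times_divide_eq_right)
    moreover have "?w * \<psi> z i / 2 \<in> \<O>" if "i < m" for i
      using a[of i] that by (simp add: \<psi>_def)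
    moreover have "?w * \<psi> z m / 2 = (z m + z (Suc m)) / 2"
      by (simp add: \<psi>_def norm norm' field_simps)
    moreover have "?w' * \<psi> z (Suc m) / 2 = (z m - z (Suc m)) / 2"
      by (simp add: \<psi>_def norm norm' field_simps)
    ultimately show ?thesis
      unfolding constrA_code2 using b c by (simp only: less_Suc_eq mem_Collect_eq) metis
  qed
  have \<phi>_norm: "herm_norm ?n (\<phi> z) = herm_norm ?n z" for z
  proof -
    \<comment> \<open>Parallelogram law. Below, \<open>a\<close> and \<open>b\<close> are taken
      without the factor 1/2, so the norm 2 of \<open>omega l\<close> cancels the
      denominator.\<close>
    have par: "(a + b) / 2 * cnj ((a + b) / 2) + (a - b) / 2 * cnj ((a - b) / 2) =
        (a * cnj a + b * cnj b) / 2" for a b :: complex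
      by (simp add: field_simps)
    define a b where "a = ?w * z m" and "b = ?w' * z (Suc m)"
    have "a * cnj a = ?w * ?w' * (z m * cnj (z m))" "b * cnj b = ?w * ?w' * (z (Suc m) * cnj (z (Suc m)))"
      by (simp_all add: a_def b_def mult_ac)
    then have ab: "a * cnj a = 2 * (z m * cnj (z m))" "b * cnj b = 2 * (z (Suc m) * cnj (z (Suc m)))"
      by (simp_all only: norm)
    have "herm_norm ?n (\<phi> z) = (\<Sum>i<m. z i * cnj (z i)) +
        ((a + b) / 2 * cnj ((a + b) / 2) + (a - b) / 2 * cnj ((a - b) / 2))"
      by (simp add: herm_norm_def \<phi>_def a_def b_def add.assoc)
    also have "\<dots> = herm_norm ?n z"
      unfolding par ab by (simp add: herm_norm_def)
    finally show ?thesis .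
  qed
  have "card {z \<in> ?L1. herm_norm ?n z = of_nat k} = card {z \<in> ?L2. herm_norm ?n z = of_nat k}" for k
  proof -
    have "herm_norm ?n (\<psi> z) = herm_norm ?n z" for z using \<phi>_norm[of "\<psi> z"] by (simp add: \<phi>\<psi>)
    then have "bij_betw \<psi> {z \<in> ?L1. herm_norm ?n z = of_nat k} {z \<in> ?L2. herm_norm ?n z = of_nat k}"
      by (intro bij_betw_byWitness[where f' = \<phi>]) (auto simp: \<phi>\<psi> \<psi>\<phi> \<phi>_mem \<psi>_mem \<phi>_norm)
    then show ?thesis by (rule bij_betw_same_card)
  qed
  then show ?thesis by (simp add: theta_def)
qed

section \<open>Inequality of the theta series at levels above 7\<close>

text \<open>Smallness forces \<open>x\<close> to be a rational integer, either divisibility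
  condition forces it to be even, and a nonzero even integer has norm at least 4.\<close>

lemma short_vector_eq_0:
  assumes l: "l > 7" and x: "x \<in> \<O>" and small: "(cmod x)\<^sup>2 \<le> 2"
    and ann: "omega l * x / 2 \<in> \<O> \<or> cnj (omega l) * x / 2 \<in> \<O>"
  shows "x = 0"
proof -
  obtain a b where ab: "x = of_int a + of_int b * omega l" using x unfolding OK_iff by blast
  have "complex_of_real ((cmod x)\<^sup>2) = complex_of_real (of_int ((2 * a - b) ^ 2 + l * b ^ 2) / 4)"
    unfolding complex_norm_square by (simp only: ab norm_OK[OF pos]) simp
  then have "(cmod x)\<^sup>2 = of_int ((2 * a - b) ^ 2 + l * b ^ 2) / 4"
    by (simp only: of_real_eq_iff)
  with small have "real_of_int ((2 * a - b) ^ 2 + l * b ^ 2) \<le> of_int 8" by simp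
  then have le: "(2 * a - b) ^ 2 + l * b ^ 2 \<le> 8" by (simp only: of_int_le_iff)
  \<comment> \<open>The next integer after 7 in its class modulo 8 is 15, already larger than the
    bound 8.\<close>
  have l15: "l \<ge> 15" using l l7 unfolding cong_def by presburger
  have b: "b = 0"
  proof (rule ccontr)
    assume "b \<noteq> 0"
    then have "1 \<le> b ^ 2" by (simp add: int_one_le_iff_zero_less)
    then have "15 * 1 \<le> l * b ^ 2" using l15 by (intro mult_mono) auto
    moreover have "0 \<le> (2 * a - b) ^ 2" by simp
    ultimately show False using le by linarith
  qed
  have "Im (omega l) \<noteq> 0" using pos by (simp add: omega_complex)
  obtain c d where "omega l * of_int a / 2 = of_int c + of_int d * omega l \<or>
      cnj (omega l) * of_int a / 2 = of_int c + of_int d * omega l"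
    using ann unfolding ab b OK_iff by auto
  \<comment> \<open>Imaginary parts suffice: they read off the coefficient of
    \<open>omega l\<close>, which is a/2 up to sign and must be an integer.\<close>
  then have "Im (omega l) * (a / 2) = Im (omega l) * d \<or> Im (omega l) * (a / 2) = Im (omega l) * - d"
  proof (elim disjE)
    assume "omega l * of_int a / 2 = of_int c + of_int d * omega l"
    from arg_cong[OF this, of Im] show ?thesis by simp
  next
    assume "cnj (omega l) * of_int a / 2 = of_int c + of_int d * omega l"
    from arg_cong[OF this, of Im] have "Im (omega l) * (a / 2) = Im (omega l) * - d"
      by (simp add: algebra_simps)
    then show ?thesis ..
  qed
  then have "real_of_int a / 2 = d \<or> real_of_int a / 2 = - d"
    using \<open>Im (omega l) \<noteq> 0\<close> by (simp only: mult_cancel_left) simp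
  then have "a = 2 * d \<or> a = - 2 * d" by linarith
  \<comment> \<open>With \<open>b = 0\<close> the quadratic form is (2a)^2, and a is 2d up to
    sign.\<close>
  then have "16 * d\<^sup>2 \<le> 8" using le by (auto simp: b power2_eq_square)
  then have "d\<^sup>2 \<le> 0" by linarith
  then have "d = 0" by simp
  with \<open>a = 2 * d \<or> a = - 2 * d\<close> show ?thesis by (auto simp: ab b)
qed

lemma theta_code_neq:
  assumes l: "l > 7"
  shows "theta (Suc (Suc m)) (constrA l (Suc (Suc m)) (code1 l (Suc (Suc m)))) \<noteq>
    theta (Suc (Suc m)) (constrA l (Suc (Suc m)) (code2 l (Suc (Suc m))))"
proof -
  let ?n = "Suc (Suc m)"
  let ?L1 = "constrA l ?n (code1 l ?n)" and ?L2 = "constrA l ?n (code2 l ?n)"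
  define w :: "nat \<Rightarrow> complex" where "w = (\<lambda>i\<in>{..<?n}. if i < m then 0 else 1)"
  have "w \<in> {z \<in> ?L1. herm_norm ?n z = of_nat 2}"
    unfolding constrA_code1 by (auto simp: w_def vecs_def herm_norm_def)
  \<comment> \<open>An infinite set would have \<open>card\<close> 0, so the witness alone does not
    make the coefficient nonzero.\<close>
  moreover have "finite {z \<in> ?L1. herm_norm ?n z = of_nat 2}"
    by (rule finite_herm_norm[OF pos sf l3]) (auto simp: constrA_def)
  ultimately have "card {z \<in> ?L1. herm_norm ?n z = of_nat 2} \<noteq> 0"
    by (metis card_0_eq empty_iff)
  moreover have "herm_norm ?n z \<noteq> of_nat 2" if z: "z \<in> ?L2" for z
  proof
    assume h: "herm_norm ?n z = of_nat 2"
    have "(\<Sum>i<?n. (cmod (z i))\<^sup>2) = Re (herm_norm ?n z)"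
      by (simp add: herm_norm_def complex_norm_square[symmetric] del: sum.lessThan_Suc
          flip: of_real_sum of_real_power)
    then have s: "(\<Sum>i<?n. (cmod (z i))\<^sup>2) = 2" by (simp only: h) simp
    \<comment> \<open>The squared moduli are nonnegative and sum to 2, so each is at most 2. The
      last coordinate satisfies the conjugate divisibility condition, the others the plain
      one.\<close>
    have "z i = 0" if i: "i < ?n" for i
    proof (rule short_vector_eq_0[OF l])
      show "z i \<in> \<O>" using z i by (auto simp: constrA_def vecs_def)
      show "(cmod (z i))\<^sup>2 \<le> 2"
        unfolding s[symmetric] using i by (intro member_le_sum) auto
      show "omega l * z i / 2 \<in> \<O> \<or> cnj (omega l) * z i / 2 \<in> \<O>"
        using z i unfolding constrA_code2 by (auto simp: less_Suc_eq)
    qed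
    then show False using s by simp
  qed
  then have "{z \<in> ?L2. herm_norm ?n z = of_nat 2} = {}" by blast
  then have "card {z \<in> ?L2. herm_norm ?n z = of_nat 2} = 0" by (metis card.empty)
  ultimately have "fps_nth (theta ?n ?L1) 2 \<noteq> fps_nth (theta ?n ?L2) 2"
    by (simp add: theta_def del: card_0_eq card_eq_0_iff)
  then show ?thesis by metis
qed

end

section \<open>Assembly of the three assertions\<close>

theorem theorem3p3:
  fixes n :: nat
  assumes "n \<ge> 2"
  shows
    "(\<forall>l::int. l > 0 \<and> squarefree l \<and> [l = 7] (mod 8) \<longrightarrow>
        swe l n (code1 l n) \<noteq> swe l n (code2 l n)) \<and>
     theta n (constrA 7 n (code1 7 n)) = theta n (constrA 7 n (code2 7 n)) \<and>
     (\<forall>l::int. l > 7 \<and> squarefree l \<and> [l = 7] (mod 8) \<longrightarrow>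
        theta n (constrA l n (code1 l n)) \<noteq> theta n (constrA l n (code2 l n)))"
proof -
  obtain m where n: "n = Suc (Suc m)"
    using assms by (metis add_2_eq_Suc le_Suc_ex)
  have "prime (7 :: int)"
    by simp
  then have "residue_mod_two 7"
    by unfold_locales (simp_all add: squarefree_prime)
  \<comment> \<open>The norm form at a = 0, b = 1 gives (1 + 7)/4.\<close>
  moreover have "omega 7 * cnj (omega 7) = 2"
    using norm_OK[of 7 0 1] by simp
  ultimately have "theta n (constrA 7 n (code1 7 n)) = theta n (constrA 7 n (code2 7 n))"
    unfolding n by (rule residue_mod_two.theta_code_eq)
  then show ?thesis
    unfolding n
    using residue_mod_two.swe_code_neq residue_mod_two.theta_code_neq
    by (auto simp: residue_mod_two_def)
qed

end
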